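(* Let $d,q,n$ be positive integers with $3\le q<d$ and $n\ge d+2$. Then any equivalent-structure learning algorithm for proper $q$-colorings and the family $\mathcal{F}$ that succeeds with probability at least $1/2$ requires $\exp(\Omega(d-q))$ independent random $q$-colorings as samples.
   Context: For a graph $G$, $\Omega_G$ is the set of proper $q$-colorings and $\pi_G$ the uniform distribution on $\Omega_G$. Let $C$ be a clique on $q-3$ vertices, $I$ an independent set on $d-q+1$ vertices, $W=\{w_1,\dots,w_{n-d-1}\}$ a simple path $w_1w_2\cdots w_{n-d-1}$, and $u,v,w$ three further vertices, all disjoint. The graph $G=(V,E)$ has vertex set $V(C)\cup V(I)\cup W\cup\{u,v,w\}$ ($n$ vertices) and edges: the edges of $C$ and of the path $W$; every vertex of $C$ adjacent to every vertex of $I$; $u$ and $v$ adjacent to every vertex of $C$ and of $I$; $w$ and $w_1$ adjacent to $v$. Let $G_1=G$, $G_2=(V,E\cup\{\{u,w\}\})$, $G_3=(V,E\cup\{\{u,w_1\}\})$, $G_4=(V,E\cup\{\{u,w\},\{u,w_1\}\})$. Let $\mathcal{G}(n,d)$ be the family of graphs on $V$ with maximum degree at most $d$; for $1\le i\le 4$ let $\mathcal{F}_i=\{G'\in\mathcal{G}(n,d):\Omega_{G'}=\Omega_{G_i}\}$ and $\mathcal{F}=\bigcup_{i=1}^4\mathcal{F}_i$. An equivalent-structure learning algorithm for $\mathcal{F}$ receives $L$ independent samples from $\pi_{G^*}$ for an unknown $G^*\in\mathcal{F}$ and outputs $G'\in\mathcal{F}$; it succeeds with probability at least $p$ if $\Pr[\Omega_{G'}=\Omega_{G^*}]\ge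 p$ for every $G^*\in\mathcal{F}$. *)

theory Defs
  imports "HOL-Probability.Probability"
begin

text \<open>A graph is a pair of a vertex set and a set of two-element edges.\<close>

type_synonym 'a ugraph = "'a set \<times> 'a set set"

definition simple_graph :: "'a ugraph \<Rightarrow> bool" where
  "simple_graph G \<longleftrightarrow>
     finite (fst G) \<and> (\<forall>e\<in>snd G. \<exists>x\<in>fst G. \<exists>y\<in>fst G. x \<noteq> y \<and> e = {x, y})"

definition degree :: "'a ugraph \<Rightarrow> 'a \<Rightarrow> nat" where
  "degree G x = card {e \<in> snd G. x \<in> e}"

text \<open>Colorings are extensional functions (\<^term>\<open>undefined\<close> outside the vertex set), so that
  distinct elements of \<open>colorings q G\<close> differ on some vertex and the uniform distribution
  on this set is the intended one.\<close>

definition colorings :: "nat \<Rightarrow> 'a ugraph \<Rightarrow> ('a \<Rightarrow> nat) set" where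
  "colorings q G =
     {f \<in> fst G \<rightarrow>\<^sub>E {1..q}. \<forall>x\<in>fst G. \<forall>y\<in>fst G. {x, y} \<in> snd G \<longrightarrow> f x \<noteq> f y}"

definition coloring_pmf :: "nat \<Rightarrow> 'a ugraph \<Rightarrow> ('a \<Rightarrow> nat) pmf" where
  "coloring_pmf q G = pmf_of_set (colorings q G)"

lemma finite_colorings: "finite (fst G) \<Longrightarrow> finite (colorings q G)"
  by (rule finite_subset[of _ "fst G \<rightarrow>\<^sub>E {1..q}"]) (auto simp: colorings_def intro: finite_PiE)

datatype vertex = Cl nat | In nat | Pa nat | U_vert | V_vert | W_vert

definition clique_part :: "nat \<Rightarrow> vertex set" where
  "clique_part q = Cl ` {1..q - 3}"

definition indep_part :: "nat \<Rightarrow> nat \<Rightarrow> vertex set" where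
  "indep_part d q = In ` {1..d - q + 1}"

definition path_part :: "nat \<Rightarrow> nat \<Rightarrow> vertex set" where
  "path_part n d = Pa ` {1..n - d - 1}"

definition vertices :: "nat \<Rightarrow> nat \<Rightarrow> nat \<Rightarrow> vertex set" where
  "vertices n d q =
     clique_part q \<union> indep_part d q \<union> path_part n d \<union> {U_vert, V_vert, W_vert}"

definition base_edges :: "nat \<Rightarrow> nat \<Rightarrow> nat \<Rightarrow> vertex set set" where
  "base_edges n d q =
     {{x, y} |x y. x \<in> clique_part q \<and> y \<in> clique_part q \<and> x \<noteq> y}
     \<union> {{Pa k, Pa (k + 1)} |k. Pa k \<in> path_part n d \<and> Pa (k + 1) \<in> path_part n d}
     \<union> {{x, y} |x y. x \<in> clique_part q \<and> y \<in> indep_part d q}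
     \<union> {{x, y} |x y. x \<in> {U_vert, V_vert} \<and> y \<in> clique_part q \<union> indep_part d q}
     \<union> {{W_vert, V_vert}, {Pa 1, V_vert}}"

definition G1 :: "nat \<Rightarrow> nat \<Rightarrow> nat \<Rightarrow> vertex ugraph" where
  "G1 n d q = (vertices n d q, base_edges n d q)"

definition G2 :: "nat \<Rightarrow> nat \<Rightarrow> nat \<Rightarrow> vertex ugraph" where
  "G2 n d q = (vertices n d q, base_edges n d q \<union> {{U_vert, W_vert}})"

definition G3 :: "nat \<Rightarrow> nat \<Rightarrow> nat \<Rightarrow> vertex ugraph" where
  "G3 n d q = (vertices n d q, base_edges n d q \<union> {{U_vert, Pa 1}})"

definition G4 :: "nat \<Rightarrow> nat \<Rightarrow> nat \<Rightarrow> vertex ugraph" where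
  "G4 n d q = (vertices n d q, base_edges n d q \<union> {{U_vert, W_vert}, {U_vert, Pa 1}})"

definition bounded_degree_graphs :: "nat \<Rightarrow> nat \<Rightarrow> nat \<Rightarrow> vertex ugraph set" where
  "bounded_degree_graphs n d q =
     {G. simple_graph G \<and> fst G = vertices n d q \<and> (\<forall>x\<in>vertices n d q. degree G x \<le> d)}"

definition equiv_class :: "nat \<Rightarrow> nat \<Rightarrow> nat \<Rightarrow> vertex ugraph \<Rightarrow> vertex ugraph set" where
  "equiv_class n d q G = {G' \<in> bounded_degree_graphs n d q. colorings q G' = colorings q G}"

definition hard_family :: "nat \<Rightarrow> nat \<Rightarrow> nat \<Rightarrow> vertex ugraph set" where
  "hard_family n d q = (\<Union>G\<in>{G1 n d q, G2 n d q, G3 n d q, G4 n d q}. equiv_class n d q G)"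

lemma card_vertices:
  assumes "3 \<le> q" "q < d" "d + 2 \<le> n"
  shows "card (vertices n d q) = n"
proof -
  have "card (clique_part q) = q - 3" "card (indep_part d q) = d - q + 1"
       "card (path_part n d) = n - d - 1"
    unfolding clique_part_def indep_part_def path_part_def
    by (subst card_image; simp add: inj_on_def)+
  moreover have "finite (clique_part q)" "finite (indep_part d q)" "finite (path_part n d)"
    by (simp_all add: clique_part_def indep_part_def path_part_def)
  moreover have "clique_part q \<inter> indep_part d q = {}"
       "(clique_part q \<union> indep_part d q) \<inter> path_part n d = {}"
       "(clique_part q \<union> indep_part d q \<union> path_part n d) \<inter> {U_vert, V_vert, W_vert} = {}"
    by (auto simp: clique_part_def indep_part_def path_part_def)
  ultimately have "card (vertices n d q) = (q - 3) + (d - q + 1) + (n - d - 1) + 3"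
    unfolding vertices_def by (simp add: card_Un_disjoint)
  with assms show ?thesis by linarith
qed

text \<open>The uniform distribution on colorings is well defined for every member of the family:
  each of the four coloring sets contains that of the fourth graph, which is nonempty.\<close>

lemma colorings_G4_nonempty:
  assumes "3 \<le> q"
  shows "colorings q (G4 n d q) \<noteq> {}"
proof -
  define g where "g x = (case x of Cl i \<Rightarrow> i | In _ \<Rightarrow> q - 1 | W_vert \<Rightarrow> q - 1
      | Pa k \<Rightarrow> (if odd k then q - 1 else q) | _ \<Rightarrow> q)" for x
  have "restrict g (vertices n d q) \<in> colorings q (G4 n d q)"
    using assms
    by (auto simp: colorings_def G4_def base_edges_def vertices_def clique_part_def
        indep_part_def path_part_def g_def doubleton_eq_iff split: if_splits)
  then show ?thesis by blast
qed

lemma colorings_nonempty: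
  assumes "3 \<le> q" "G \<in> hard_family n d q"
  shows "colorings q G \<noteq> {}"
proof -
  obtain H where H: "H \<in> {G1 n d q, G2 n d q, G3 n d q, G4 n d q}"
      "colorings q G = colorings q H"
    using assms(2) unfolding hard_family_def equiv_class_def by blast
  from H(1) have "fst H = fst (G4 n d q)" "snd H \<subseteq> snd (G4 n d q)"
    by (auto simp: G1_def G2_def G3_def G4_def)
  then have "colorings q (G4 n d q) \<subseteq> colorings q H"
    unfolding colorings_def by auto
  with H(2) colorings_G4_nonempty[OF assms(1)] show ?thesis by blast
qed

text \<open>A learning algorithm maps a list of samples to a distribution on output graphs, so
  internal randomness is allowed; no computability or running-time restriction is imposed.
  Validity of the output is only required on sample lists that can occur.\<close>

definition equiv_structure_learner ::
    "nat \<Rightarrow> 'a ugraph set \<Rightarrow> nat \<Rightarrow> (('a \<Rightarrow> nat) list \<Rightarrow> 'a ugraph pmf) \<Rightarrow> bool" where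
  "equiv_structure_learner q F L A \<longleftrightarrow>
     (\<forall>G\<in>F. \<forall>xs\<in>set_pmf (replicate_pmf L (coloring_pmf q G)). set_pmf (A xs) \<subseteq> F)"

definition succeeds_with_prob ::
    "nat \<Rightarrow> 'a ugraph set \<Rightarrow> nat \<Rightarrow> (('a \<Rightarrow> nat) list \<Rightarrow> 'a ugraph pmf) \<Rightarrow> real \<Rightarrow> bool" where
  "succeeds_with_prob q F L A p \<longleftrightarrow>
     (\<forall>G\<in>F. measure_pmf.prob (bind_pmf (replicate_pmf L (coloring_pmf q G)) A)
               {G'. colorings q G' = colorings q G} \<ge> p)"

end

theory Submission
  imports Defs
begin

text \<open>The colorings with equal colors at \<open>u\<close> and \<open>v\<close> are proper for all four graphs, and a
  uniform coloring of any of them is of this kind except with probability at most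
  \<open>1/(2 ^ (d - q) + 1)\<close>: if \<open>u\<close> and \<open>v\<close> differ, only one color is left for the independent set,
  whereas two are left if they agree. Conditioned on all samples being of this kind, the four
  sample distributions coincide, so one of the four answers is given with conditional
  probability at most \<open>1/4\<close>; success probability \<open>1/2\<close> then forces the conditioning event to
  have probability at most \<open>2/3\<close>.\<close>

section \<open>Comparing sample distributions\<close>

text \<open>The pointwise bound costs one factor \<open>c\<close> per sample. The integrand stays
  arbitrary in the induction because fixing the first sample \<open>x\<close> turns
  \<open>f xs\<close> into \<open>f (x # xs)\<close>.\<close>

lemma nn_integral_replicate_pmf_dominated:
  fixes p p' :: "'a pmf"
  assumes "\<And>x. c * pmf p' x \<le> pmf p x" "0 \<le> c"
  shows "ennreal (c ^ L) * (\<integral>\<^sup>+xs. f xs \<partial>replicate_pmf L p') \<le> (\<integral>\<^sup>+xs. f xs \<partial>replicate_pmf L p)"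
proof (induction L arbitrary: f)
  case 0
  show ?case by simp
next
  case (Suc L)
  have step: "ennreal c * (\<integral>\<^sup>+x. g x \<partial>p') \<le> (\<integral>\<^sup>+x. g x \<partial>p)" for g
  proof -
    have "ennreal c * (\<integral>\<^sup>+x. g x \<partial>p') = (\<integral>\<^sup>+x. ennreal (c * pmf p' x) * g x \<partial>count_space UNIV)"
      using assms(2)
      by (simp add: nn_integral_measure_pmf nn_integral_cmult[symmetric] ennreal_mult mult.assoc)
    also have "\<dots> \<le> (\<integral>\<^sup>+x. ennreal (pmf p x) * g x \<partial>count_space UNIV)"
      by (intro nn_integral_mono mult_right_mono ennreal_leI assms(1)) auto
    finally show ?thesis by (simp add: nn_integral_measure_pmf)
  qed
  have unfold: "(\<integral>\<^sup>+xs. f xs \<partial>replicate_pmf (Suc L) r) =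
      (\<integral>\<^sup>+x. \<integral>\<^sup>+xs. f (x # xs) \<partial>replicate_pmf L r \<partial>r)" for r :: "'a pmf"
    by simp
  have "ennreal (c ^ Suc L) * (\<integral>\<^sup>+xs. f xs \<partial>replicate_pmf (Suc L) p') =
      ennreal c * (\<integral>\<^sup>+x. ennreal (c ^ L) * (\<integral>\<^sup>+xs. f (x # xs) \<partial>replicate_pmf L p') \<partial>p')"
    unfolding unfold using assms(2) by (simp add: nn_integral_cmult ennreal_mult mult.assoc)
  also have "\<dots> \<le> ennreal c * (\<integral>\<^sup>+x. \<integral>\<^sup>+xs. f (x # xs) \<partial>replicate_pmf L p \<partial>p')"
    by (intro mult_left_mono nn_integral_mono Suc.IH) auto
  also have "\<dots> \<le> (\<integral>\<^sup>+xs. f xs \<partial>replicate_pmf (Suc L) p)"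
    unfolding unfold by (rule step)
  finally show ?case .
qed

lemma prob_bind_replicate_pmf_dominated:
  fixes p p' :: "'a pmf"
  assumes "\<And>x. c * pmf p' x \<le> pmf p x" "0 \<le> c"
  shows "c ^ L * measure_pmf.prob (bind_pmf (replicate_pmf L p') A) E
    \<le> measure_pmf.prob (bind_pmf (replicate_pmf L p) A) E"
proof -
  have "ennreal (c ^ L) * emeasure (bind_pmf (replicate_pmf L p') A) E
    \<le> emeasure (bind_pmf (replicate_pmf L p) A) E"
    using nn_integral_replicate_pmf_dominated[OF assms]
    by (simp add: emeasure_bind_pmf)
  then show ?thesis
    using assms(2)
    by (simp add: measure_pmf.emeasure_eq_measure ennreal_mult[symmetric])
qed

text \<open>Conditioning on all samples lying in \<open>S\<close> is replaced by domination:
  \<open>card S / card \<Omega>\<close> times the mass \<open>1 / card S\<close> is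
  \<open>1 / card \<Omega>\<close>. The bound is applied to the failure event \<open>- E\<close>,
  whose probability under samples from \<open>\<Omega>\<close> is at most 1/2.\<close>

lemma success_prob_from_subset_samples:
  assumes "S \<subseteq> \<Omega>" "finite \<Omega>" "S \<noteq> {}"
    and "1/2 \<le> measure_pmf.prob (bind_pmf (replicate_pmf L (pmf_of_set \<Omega>)) A) E"
  shows "(card S / card \<Omega>) ^ L *
    (1 - measure_pmf.prob (bind_pmf (replicate_pmf L (pmf_of_set S)) A) E) \<le> 1/2"
proof -
  have fin: "finite S" "\<Omega> \<noteq> {}" using assms finite_subset by auto
  then have "card S > 0" "card \<Omega> > 0" using assms by (auto simp: card_gt_0_iff)
  then have dom: "card S / card \<Omega> * pmf (pmf_of_set S) x \<le> pmf (pmf_of_set \<Omega>) x" for x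
    using assms fin by (auto simp: pmf_of_set indicator_def)
  have "measure_pmf.prob M (- E) = 1 - measure_pmf.prob M E" for M :: "'b pmf"
    using measure_pmf.prob_compl[of E M] by (simp add: Compl_eq_Diff_UNIV)
  then show ?thesis
    using prob_bind_replicate_pmf_dominated[OF dom, of L A "- E"] assms(4) by simp
qed

section \<open>Forced colors when u and v differ\<close>

lemma same_missing_color:
  fixes B :: "nat set"
  assumes "B \<subseteq> {1..q}" "card B = q - 1" "x \<in> {1..q} - B" "y \<in> {1..q} - B"
  shows "x = y"
proof -
  have "card ({1..q} - B) = q - (q - 1)"
    using assms by (simp add: card_Diff_subset finite_subset)
  then have "card ({1..q} - B) \<le> 1" by simp
  then show ?thesis using assms(3,4)
    by (metis card_le_Suc0_iff_eq finite_Diff finite_atLeastAtMost One_nat_def)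
qed

lemma base_edgesI:
  "x \<in> clique_part q \<Longrightarrow> y \<in> clique_part q \<Longrightarrow> x \<noteq> y \<Longrightarrow> {x, y} \<in> base_edges n d q"
  "x \<in> clique_part q \<Longrightarrow> y \<in> indep_part d q \<Longrightarrow> {x, y} \<in> base_edges n d q"
  "x \<in> clique_part q \<union> indep_part d q \<Longrightarrow> {U_vert, x} \<in> base_edges n d q"
  "x \<in> clique_part q \<union> indep_part d q \<Longrightarrow> {V_vert, x} \<in> base_edges n d q"
  "{W_vert, V_vert} \<in> base_edges n d q" "{Pa 1, V_vert} \<in> base_edges n d q"
  unfolding base_edges_def by blast+

lemma base_edgesE:
  assumes "e \<in> base_edges n d q"
  obtains x y where "e = {x, y}" "x \<in> clique_part q" "y \<in> clique_part q" "x \<noteq> y"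
    | k where "e = {Pa k, Pa (k + 1)}" "Pa k \<in> path_part n d" "Pa (k + 1) \<in> path_part n d"
    | x y where "e = {x, y}" "x \<in> clique_part q" "y \<in> indep_part d q"
    | x y where "e = {x, y}" "x \<in> {U_vert, V_vert}" "y \<in> clique_part q"
    | x y where "e = {x, y}" "x \<in> {U_vert, V_vert}" "y \<in> indep_part d q"
    | "e = {W_vert, V_vert}" | "e = {Pa 1, V_vert}"
  using assms unfolding base_edges_def by (elim UnE CollectE exE conjE insertE) blast+

lemma coloring_G1D:
  assumes "f \<in> colorings q (G1 n d q)"
  shows "x \<in> vertices n d q \<Longrightarrow> y \<in> vertices n d q \<Longrightarrow> {x, y} \<in> base_edges n d q \<Longrightarrow> f x \<noteq> f y"
    and "x \<in> vertices n d q \<Longrightarrow> f x \<in> {1..q}"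
    and "x \<notin> vertices n d q \<Longrightarrow> f x = undefined"
  using assms by (auto simp: colorings_def G1_def PiE_def extensional_def Pi_def)

lemma coloring_G1_neq:
  assumes "f \<in> colorings q (G1 n d q)"
  shows "x \<in> clique_part q \<Longrightarrow> y \<in> clique_part q \<Longrightarrow> x \<noteq> y \<Longrightarrow> f x \<noteq> f y"
    and "x \<in> clique_part q \<Longrightarrow> y \<in> indep_part d q \<Longrightarrow> f x \<noteq> f y"
    and "x \<in> clique_part q \<union> indep_part d q \<Longrightarrow> f U_vert \<noteq> f x"
    and "x \<in> clique_part q \<union> indep_part d q \<Longrightarrow> f V_vert \<noteq> f x"
    and "f W_vert \<noteq> f V_vert"
    and "Pa 1 \<in> vertices n d q \<Longrightarrow> f (Pa 1) \<noteq> f V_vert"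
  by (rule coloring_G1D(1)[OF assms]; (erule (2) base_edgesI | erule (1) base_edgesI
        | erule base_edgesI | rule base_edgesI | blast | simp add: vertices_def | auto simp: vertices_def))+

text \<open>The clique takes \<open>q - 3\<close> colors and u, v two more, which leaves a single
  color for the independent set. Likewise the clique, v and one independent vertex leave only the
  color of u; this is what makes recoloring reversible.\<close>

lemma coloring_G1_endpoints_differ:
  assumes f: "f \<in> colorings q (G1 n d q)" and ne: "f U_vert \<noteq> f V_vert" and q: "3 \<le> q"
    and x: "x \<in> indep_part d q"
  shows coloring_G1_indep_part_constant: "y \<in> indep_part d q \<Longrightarrow> f y = f x"
    and coloring_G1_missing_color:
      "c \<in> {1..q} - (f ` clique_part q \<union> {f V_vert, f x}) \<Longrightarrow> c = f U_vert"
proof -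
  have V: "U_vert \<in> vertices n d q" "V_vert \<in> vertices n d q"
    "clique_part q \<subseteq> vertices n d q" "indep_part d q \<subseteq> vertices n d q"
    by (auto simp: vertices_def)
  note rg = coloring_G1D(2)[OF f]
  have inj: "inj_on f (clique_part q)"
    unfolding inj_on_def using coloring_G1_neq(1)[OF f] by metis
  have cC: "card (f ` clique_part q) = q - 3" "finite (f ` clique_part q)"
    using card_image[OF inj] by (simp_all add: clique_part_def card_image[OF inj] card_image inj_on_def)
  have nU: "f U_vert \<notin> f ` clique_part q" and nV: "f V_vert \<notin> f ` clique_part q"
    using coloring_G1_neq(3,4)[OF f] by blast+
  have nI: "f y \<notin> f ` clique_part q" "f y \<noteq> f U_vert" "f y \<noteq> f V_vert" if y: "y \<in> indep_part d q" for y
    using coloring_G1_neq(2-4)[OF f] y by force+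
  let ?B = "f ` clique_part q \<union> {f U_vert, f V_vert}"
  have B: "?B \<subseteq> {1..q}" "card ?B = q - 1"
    using rg V nU nV ne cC q by (auto simp: card_insert_if)
  show "f y = f x" if "y \<in> indep_part d q"
    by (rule same_missing_color[OF B]) (use nI that x rg V in auto)
  let ?B' = "f ` clique_part q \<union> {f V_vert, f x}"
  have B': "?B' \<subseteq> {1..q}" "card ?B' = q - 1"
    using rg V nU nV ne cC q nI[OF x] x by (auto simp: card_insert_if)
  show "c = f U_vert" if "c \<in> {1..q} - ?B'"
    by (rule same_missing_color[OF B']) (use nU nI[OF x] that x rg V ne in auto)
qed

section \<open>Injection into colorings with u and v equal\<close>

definition merged_colorings :: "nat \<Rightarrow> nat \<Rightarrow> nat \<Rightarrow> (vertex \<Rightarrow> nat) set" where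
  "merged_colorings n d q = {f \<in> colorings q (G1 n d q). f U_vert = f V_vert}"

text \<open>Only sets \<open>X\<close> with \<open>1 \<notin> X\<close> are used: the unchanged color of \<open>In 1\<close> and that of \<open>v\<close> then
  determine the lost color of \<open>u\<close> as the only one missing.\<close>

definition recolor :: "(vertex \<Rightarrow> nat) \<Rightarrow> nat set \<Rightarrow> vertex \<Rightarrow> nat" where
  "recolor f X x = (if x = U_vert then f V_vert
     else if x \<in> In ` X then f U_vert else f x)"

text \<open>The color of v is absent from the clique and the independent set, so u may take it. Any
  subset of the independent set may then take the old color of u: its neighbours are u, v and the
  clique, and none of them has that color any more.\<close>

lemma recolor_in_merged_colorings:
  assumes f: "f \<in> colorings q (G1 n d q)" and ne: "f U_vert \<noteq> f V_vert"
    and X: "X \<subseteq> {2..d - q + 1}"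
  shows "recolor f X \<in> merged_colorings n d q"
proof -
  note ed = coloring_G1D(1)[OF f] and rg = coloring_G1D(2)[OF f] and ud = coloring_G1D(3)[OF f]
  have V: "U_vert \<in> vertices n d q" "V_vert \<in> vertices n d q"
    "In ` X \<subseteq> indep_part d q" "indep_part d q \<subseteq> vertices n d q"
    "clique_part q \<subseteq> vertices n d q" 
    using X by (auto simp: vertices_def indep_part_def)
  have "recolor f X x \<in> {1..q}" if "x \<in> vertices n d q" for x
    using rg that V unfolding recolor_def by auto
  moreover have "recolor f X x = undefined" if "x \<notin> vertices n d q" for x
    using ud that V unfolding recolor_def by auto
  moreover have "recolor f X x \<noteq> recolor f X y"
    if xy: "x \<in> vertices n d q" "y \<in> vertices n d q" "{x, y} \<in> base_edges n d q" for x y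
  proof -
    \<comment> \<open>\<open>W_vert\<close> and \<open>Pa 1\<close> are not adjacent to u in
      \<open>G1\<close>, so they do not hinder the new color of u.\<close>
    have nbU: "z \<in> clique_part q \<union> indep_part d q" if "{U_vert, z} \<in> base_edges n d q" for z
      using that by (auto simp: base_edges_def doubleton_eq_iff clique_part_def indep_part_def)
    have nbI: "z \<in> clique_part q \<union> {U_vert, V_vert}" 
      if "{y, z} \<in> base_edges n d q" "y \<in> indep_part d q" for y z
      using that by (auto simp: base_edges_def doubleton_eq_iff clique_part_def indep_part_def)
    have U: "recolor f X z \<noteq> f V_vert" if "{U_vert, z} \<in> base_edges n d q" for z
    proof -
      have z: "z \<in> clique_part q \<union> indep_part d q" by (rule nbU[OF that])
      then have "z \<noteq> U_vert" "f V_vert \<noteq> f z"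
        using coloring_G1_neq(4)[OF f z] by (auto simp: clique_part_def indep_part_def)
      then show ?thesis using ne by (simp add: recolor_def)
    qed
    have I: "recolor f X z \<noteq> f U_vert"
      if "{y, z} \<in> base_edges n d q" "y \<in> In ` X" for y z
    proof -
      have z: "z \<in> clique_part q \<union> {U_vert, V_vert}" using nbI that V by blast
      then have "z \<notin> In ` X" by (auto simp: clique_part_def)
      moreover have "f U_vert \<noteq> f z" if "z \<in> clique_part q"
        using coloring_G1_neq(3)[OF f] that by blast
      ultimately show ?thesis using ne z by (auto simp: recolor_def)
    qed
    have sym: "{y, x} \<in> base_edges n d q" using xy(3) by (simp add: insert_commute)
    \<comment> \<open>Each kind of change occurs at either end of the edge; in the last case neither
      end changes color.\<close>
    consider "x = U_vert" | "y = U_vert" | "x \<in> In ` X" "y \<noteq> U_vert" | "y \<in> In ` X" "x \<noteq> U_vert"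
      | "x \<noteq> U_vert" "x \<notin> In ` X" "y \<noteq> U_vert" "y \<notin> In ` X" by blast
    then show ?thesis
    proof cases
      case 1 then show ?thesis using U[of y] xy(3) by (auto simp: recolor_def)
    next
      case 2 then show ?thesis using U[of x] sym by (auto simp: recolor_def)
    next
      case 3 then show ?thesis using I[OF xy(3)] by (auto simp: recolor_def)
    next
      case 4 then show ?thesis using I[OF sym] by (auto simp: recolor_def)
    next
      case 5 then show ?thesis using ed[OF xy] by (auto simp: recolor_def)
    qed
  qed
  moreover have "recolor f X U_vert = recolor f X V_vert"
    by (auto simp: recolor_def)
  ultimately show ?thesis
    by (auto simp: merged_colorings_def colorings_def G1_def PiE_def extensional_def)
qed

text \<open>Decoding: the clique, v and \<open>In 1\<close> keep their colors. They determine the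
  color of u as the only one missing, and \<open>In 1\<close> shows the common color of the
  independent set. Finally \<open>X\<close> is read off from the vertices that carry the old color
  of u.\<close>

lemma recolor_inj_on:
  assumes "3 \<le> q"
  shows "inj_on (\<lambda>(f, X). recolor f X)
    ({f \<in> colorings q (G1 n d q). f U_vert \<noteq> f V_vert} \<times> Pow {2..d - q + 1})"
proof (rule inj_onI, clarify)
  fix f X f' X'
  assume f: "f \<in> colorings q (G1 n d q)" "f U_vert \<noteq> f V_vert"
    and f': "f' \<in> colorings q (G1 n d q)" "f' U_vert \<noteq> f' V_vert"
    and X: "X \<subseteq> {2..d - q + 1}" "X' \<subseteq> {2..d - q + 1}"
    and eq: "recolor f X = recolor f' X'"
  have I1: "In 1 \<in> indep_part d q" by (simp add: indep_part_def)
  have eqx: "recolor f X x = recolor f' X' x" for x using eq by simp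
  \<comment> \<open>These vertices are untouched by every admissible set, hence by both
    \<open>X\<close> and \<open>X'\<close>.\<close>
  have a1: "f x = f' x" if "x \<noteq> U_vert" "x \<notin> In ` {2..d - q + 1}" for x
  proof -
    have "x \<notin> In ` X" "x \<notin> In ` X'" using that X by blast+
    then show ?thesis using eqx[of x] that by (simp add: recolor_def)
  qed
  have V: "f V_vert = f' V_vert" and I: "f (In 1) = f' (In 1)"
    by (rule a1; auto)+
  have C: "f ` clique_part q = f' ` clique_part q"
    by (rule image_cong[OF refl], rule a1) (auto simp: clique_part_def)
  have U: "f U_vert = f' U_vert"
  proof (rule coloring_G1_missing_color[OF f' assms I1])
    have "f U_vert \<noteq> f z" if "z \<in> clique_part q \<union> indep_part d q" for z
      by (rule coloring_G1_neq(3)[OF f(1) that])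
    then have "f U_vert \<notin> f ` clique_part q \<union> {f V_vert, f (In 1)}"
      using f(2) I1 by blast
    moreover have "f U_vert \<in> {1..q}" by (rule coloring_G1D(2)[OF f(1)]) (simp add: vertices_def)
    ultimately show "f U_vert \<in> {1..q} - (f' ` clique_part q \<union> {f' V_vert, f' (In 1)})"
      unfolding C V I by auto
  qed
  have "f x = f' x" for x
  proof (cases "x \<in> indep_part d q")
    case True
    then show ?thesis
      using coloring_G1_indep_part_constant[OF f assms I1 True]
        coloring_G1_indep_part_constant[OF f' assms I1 True] I by simp
  next
    case False
    then have "x \<notin> In ` {2..d - q + 1}" by (auto simp: indep_part_def)
    then show ?thesis using a1[of x] U by (cases "x = U_vert") auto
  qed
  then have ff: "f = f'" by (rule ext)
  \<comment> \<open>Under \<open>f\<close> itself \<open>In j\<close> never has the color of u, so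
    it shows that color after recoloring exactly if \<open>j\<close> is in the set.\<close>
  have "j \<in> X \<longleftrightarrow> j \<in> X'" if j: "j \<in> {2..d - q + 1}" for j
  proof -
    have jI: "In j \<in> indep_part d q" using j by (auto simp: indep_part_def)
    have "f U_vert \<noteq> f (In j)"
      using coloring_G1_neq(3)[OF f(1)] jI by blast
    then show ?thesis using eqx[of "In j"] ff by (auto simp: recolor_def image_iff split: if_splits)
  qed
  then have "X = X'" using X by blast
  with ff show "f = f' \<and> X = X'" by simp
qed

lemma finite_vertices: "finite (vertices n d q)"
  by (simp add: vertices_def clique_part_def indep_part_def path_part_def)

lemma finite_colorings_G1: "finite (colorings q (G1 n d q))"
  by (rule finite_colorings) (simp add: G1_def finite_vertices)

text \<open>\<open>{2..d - q + 1}\<close> has \<open>d - q\<close> elements, so by injectivity the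
  merged colorings number at least \<open>2 ^ (d - q)\<close> times the remaining ones. The product
  form keeps the ratio within the natural numbers.\<close>

lemma card_merged_colorings:
  assumes "3 \<le> q"
  shows "2 ^ (d - q) * card (colorings q (G1 n d q))
    \<le> (2 ^ (d - q) + 1) * card (merged_colorings n d q)"
proof -
  let ?\<Omega> = "colorings q (G1 n d q)"
  let ?T = "{f \<in> ?\<Omega>. f U_vert \<noteq> f V_vert}"
  have "finite (merged_colorings n d q)"
    by (simp add: merged_colorings_def finite_colorings_G1)
  then have "card (?T \<times> Pow {2..d - q + 1}) \<le> card (merged_colorings n d q)"
    by (intro card_inj_on_le[OF recolor_inj_on[OF assms]])
      (auto intro!: recolor_in_merged_colorings)
  then have "card ?T * 2 ^ (d - q) \<le> card (merged_colorings n d q)"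
    by (simp add: card_cartesian_product card_Pow)
  moreover have "card ?\<Omega> = card ?T + card (merged_colorings n d q)"
    by (subst card_Un_disjoint[symmetric])
      (auto simp: merged_colorings_def finite_colorings_G1 intro!: arg_cong[where f = card])
  ultimately show ?thesis by (simp add: algebra_simps)
qed

section \<open>Common colorings and membership in the family\<close>

lemma colorings_antimono:
  "fst G = fst H \<Longrightarrow> snd G \<subseteq> snd H \<Longrightarrow> colorings q H \<subseteq> colorings q G"
  unfolding colorings_def by auto

text \<open>v is adjacent to \<open>W_vert\<close> and \<open>Pa 1\<close> already in
  \<open>G1\<close>, so once u shares its color the edges added at u hold automatically.\<close>

lemma merged_colorings_subset_G4: "merged_colorings n d q \<subseteq> colorings q (G4 n d q)"
proof
  fix f assume "f \<in> merged_colorings n d q"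
  then have f: "f \<in> colorings q (G1 n d q)" and eq: "f U_vert = f V_vert"
    by (auto simp: merged_colorings_def)
  have "f W_vert \<noteq> f V_vert"
    by (rule coloring_G1_neq(5)[OF f])
  moreover have "f (Pa 1) \<noteq> f V_vert" if "Pa 1 \<in> vertices n d q"
    by (rule coloring_G1_neq(6)[OF f that])
  ultimately show "f \<in> colorings q (G4 n d q)"
    using f eq by (auto simp: colorings_def G1_def G4_def doubleton_eq_iff)
qed

lemma degree_le_card_neighbours:
  assumes "finite N" "\<And>e. e \<in> snd G \<Longrightarrow> x \<in> e \<Longrightarrow> \<exists>y\<in>N. e = {x, y}"
  shows "degree G x \<le> card N"
proof -
  have "{e \<in> snd G. x \<in> e} \<subseteq> (\<lambda>y. {x, y}) ` N" using assms(2) by blast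
  then have "degree G x \<le> card ((\<lambda>y. {x, y}) ` N)"
    unfolding degree_def using assms(1) by (intro card_mono) auto
  also have "\<dots> \<le> card N" by (rule card_image_le[OF assms(1)])
  finally show ?thesis .
qed

text \<open>u and v have \<open>(q - 3) + (d - q + 1) = d - 2\<close> neighbours in the clique and
  the independent set, and at most two more. On the path 4 neighbours suffice, and
  \<open>4 \<le> d\<close>.\<close>

lemma degree_G4:
  assumes "3 \<le> q" "q < d"
  shows "degree (G4 n d q) x \<le> d"
proof -
  \<comment> \<open>Supersets of the neighbourhoods are enough: \<open>Pa 0\<close> and, for
    \<open>k > 1\<close>, \<open>U_vert\<close> and \<open>V_vert\<close> do no harm.\<close>
  define N where "N = (case x of
      Cl _ \<Rightarrow> clique_part q \<union> indep_part d q \<union> {U_vert, V_vert}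
    | In _ \<Rightarrow> clique_part q \<union> {U_vert, V_vert}
    | Pa k \<Rightarrow> {Pa (k - 1), Pa (k + 1), U_vert, V_vert}
    | W_vert \<Rightarrow> {U_vert, V_vert}
    | _ \<Rightarrow> clique_part q \<union> indep_part d q \<union> {W_vert, Pa 1})"
  have c: "card (clique_part q) = q - 3" "card (indep_part d q) = d - q + 1"
    by (simp_all add: clique_part_def indep_part_def card_image inj_on_def)
  have ci: "card (clique_part q \<union> indep_part d q) \<le> d - 2"
    using card_Un_le[of "clique_part q" "indep_part d q"] c assms by simp
  have two: "card (A \<union> {a, b}) \<le> card A + 2" for A :: "vertex set" and a b
    using card_Un_le[of A "{a, b}"] card_insert_le_m1[of 2 "{b}" a] by simp
  have fin: "finite N"
    by (auto simp: N_def clique_part_def indep_part_def split: vertex.split)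
  have "\<exists>y\<in>N. e = {x, y}" if e: "e \<in> snd (G4 n d q)" "x \<in> e" for e
    using that unfolding G4_def base_edges_def N_def
    by (cases x) (auto simp: clique_part_def indep_part_def path_part_def insert_commute)
  then have "degree (G4 n d q) x \<le> card N"
    by (intro degree_le_card_neighbours fin) auto
  also have "\<dots> \<le> d"
  proof (cases x)
    case (Pa k)
    have "card N \<le> 4" unfolding N_def Pa by (simp add: card_insert_if)
    then show ?thesis using assms by simp
  qed (use two[of "clique_part q \<union> indep_part d q" U_vert V_vert]
           two[of "clique_part q" U_vert V_vert]
           two[of "clique_part q \<union> indep_part d q" W_vert "Pa 1"] ci c assms in \<open>auto simp: N_def\<close>)
  finally show ?thesis .
qed

text \<open>\<open>G4\<close> contains the edges of the other three graphs and removing edges only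
  lowers degrees, so one degree computation serves all four.\<close>

lemma subgraph_of_G4_bounded_degree:
  assumes "3 \<le> q" "q < d" "d + 2 \<le> n"
    and "fst G = vertices n d q" "snd G \<subseteq> snd (G4 n d q)"
  shows "G \<in> bounded_degree_graphs n d q"
proof -
  have edges: "\<exists>x\<in>vertices n d q. \<exists>y\<in>vertices n d q. x \<noteq> y \<and> e = {x, y}"
    if e: "e \<in> snd (G4 n d q)" for e
  proof -
    have Pa1: "Pa 1 \<in> vertices n d q" using assms by (auto simp: vertices_def path_part_def)
    consider "e \<in> base_edges n d q" | "e = {U_vert, W_vert}" | "e = {U_vert, Pa 1}"
      using e unfolding G4_def by auto
    then show ?thesis
    proof cases
      case 1
      then show ?thesis
      proof (cases rule: base_edgesE)
        case (2 k)
        then show ?thesis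
          by (intro bexI[of _ "Pa k"] bexI[of _ "Pa (k + 1)"]) (auto simp: vertices_def)
      next
        case 6
        then show ?thesis
          by (intro bexI[of _ W_vert] bexI[of _ V_vert]) (auto simp: vertices_def)
      next
        case 7
        then show ?thesis using Pa1
          by (intro bexI[of _ "Pa 1"] bexI[of _ V_vert]) (auto simp: vertices_def)
      next
        case (1 x y)
        then show ?thesis unfolding vertices_def by blast
      next
        case (3 x y)
        then show ?thesis
          by (intro bexI[of _ x] bexI[of _ y])
            (auto simp: vertices_def clique_part_def indep_part_def)
      next
        case (4 x y)
        then show ?thesis
          by (intro bexI[of _ x] bexI[of _ y]) (auto simp: vertices_def clique_part_def)
      next
        case (5 x y)
        then show ?thesis
          by (intro bexI[of _ x] bexI[of _ y]) (auto simp: vertices_def indep_part_def)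
      qed
    next
      case 2
      then show ?thesis
        by (intro bexI[of _ U_vert] bexI[of _ W_vert]) (auto simp: vertices_def)
    next
      case 3
      then show ?thesis using Pa1
        by (intro bexI[of _ U_vert] bexI[of _ "Pa 1"]) (auto simp: vertices_def)
    qed
  qed
  then have "snd (G4 n d q) \<subseteq> Pow (vertices n d q)" by blast
  then have fin: "finite (snd (G4 n d q))"
    by (rule finite_subset) (simp add: finite_vertices)
  have "degree G x \<le> d" for x
  proof -
    have "degree G x \<le> degree (G4 n d q) x"
      unfolding degree_def using fin assms(5) by (intro card_mono) auto
    then show ?thesis using degree_G4[OF assms(1,2), of n x] by simp
  qed
  then show ?thesis
    using edges assms(4,5) finite_vertices
    by (auto simp: bounded_degree_graphs_def simple_graph_def)
qed

section \<open>Separating the four coloring sets\<close>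

text \<open>Edges are tested without orientation, so one case per kind of edge in
  \<open>base_edgesE\<close> is enough.\<close>

lemma coloringsI_edges:
  assumes "f \<in> fst G \<rightarrow>\<^sub>E {1..q}" "\<And>e. e \<in> snd G \<Longrightarrow> \<exists>x\<in>e. \<exists>y\<in>e. f x \<noteq> f y"
  shows "f \<in> colorings q G"
  using assms by (fastforce simp: colorings_def)

lemma ex_coloring_G1:
  assumes "3 \<le> q" "d + 2 \<le> n" "a \<in> {q - 2, q}" "b \<in> {q - 2, q}"
  shows "\<exists>f \<in> colorings q (G1 n d q). f U_vert = q - 2 \<and> f W_vert = a \<and> f (Pa 1) = b"
proof -
  \<comment> \<open>Clique, u, v and independent set use up \<open>1..q - 3\<close>,
    \<open>q - 2\<close>, \<open>q - 1\<close> and \<open>q\<close>. \<open>W_vert\<close> and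
    \<open>Pa 1\<close> only have to avoid \<open>q - 1\<close>, so each may repeat or avoid the
    color of u; the path alternates \<open>b\<close> with \<open>q - 1\<close>, odd positions having
    \<open>b\<close>.\<close>
  define g where "g x = (case x of Cl i \<Rightarrow> i | In _ \<Rightarrow> q | W_vert \<Rightarrow> a | U_vert \<Rightarrow> q - 2
      | V_vert \<Rightarrow> q - 1 | Pa k \<Rightarrow> (if odd k then b else q - 1))" for x
  let ?f = "restrict g (vertices n d q)"
  have "Pa 1 \<in> vertices n d q" using assms by (simp add: vertices_def path_part_def)
  then have eq: "?f U_vert = q - 2" "?f V_vert = q - 1" "?f W_vert = a" "?f (Pa 1) = b"
    by (auto simp: vertices_def g_def)
  have C: "?f x \<in> {1..q - 3}" if "x \<in> clique_part q" for x
    using that by (auto simp: vertices_def clique_part_def g_def)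
  have Cinj: "?f x \<noteq> ?f y" if "x \<in> clique_part q" "y \<in> clique_part q" "x \<noteq> y" for x y
    using that by (auto simp: vertices_def clique_part_def g_def)
  have I: "?f x = q" if "x \<in> indep_part d q" for x
    using that by (auto simp: vertices_def indep_part_def g_def)
  have P: "?f (Pa k) \<noteq> ?f (Pa (k + 1))" if "Pa k \<in> path_part n d" "Pa (k + 1) \<in> path_part n d" for k
    using that assms by (auto simp: vertices_def g_def)
  have "?f \<in> colorings q (G1 n d q)"
  proof (rule coloringsI_edges)
    show "?f \<in> fst (G1 n d q) \<rightarrow>\<^sub>E {1..q}"
      using assms by (auto simp: G1_def vertices_def clique_part_def indep_part_def path_part_def g_def)
    fix e assume "e \<in> snd (G1 n d q)"
    then have "e \<in> base_edges n d q" by (simp add: G1_def)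
    then have "\<exists>x y. e = {x, y} \<and> ?f x \<noteq> ?f y"
    proof (cases rule: base_edgesE)
      case (3 x y)
      then show ?thesis using C[of x] I[of y] assms(1) by (intro exI[of _ x] exI[of _ y]) auto
    next
      case (4 x y)
      then have "?f x \<ge> q - 2" "?f y \<le> q - 3" using C[of y] eq by auto
      then show ?thesis using 4(1) assms(1) by (intro exI[of _ x] exI[of _ y]) auto
    next
      case (5 x y)
      then have "?f x < q" "?f y = q" using I[of y] eq assms(1) by auto
      then show ?thesis using 5(1) by (intro exI[of _ x] exI[of _ y]) auto
    next
      case 6
      then show ?thesis using eq assms by (intro exI[of _ W_vert] exI[of _ V_vert]) auto
    next
      case 7
      then show ?thesis using eq assms by (intro exI[of _ "Pa 1"] exI[of _ V_vert]) auto
    qed (use Cinj P in blast)+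
    then show "\<exists>x\<in>e. \<exists>y\<in>e. ?f x \<noteq> ?f y" by blast
  qed
  with eq show ?thesis by blast
qed

lemma colorings_insert_edge:
  assumes "a \<in> V" "b \<in> V"
  shows "colorings q (V, insert {a, b} E) = {f \<in> colorings q (V, E). f a \<noteq> f b}"
  using assms by (auto simp: colorings_def doubleton_eq_iff)

text \<open>Two colorings separate all four sets: one where u agrees with \<open>W_vert\<close> only
  lies in the first and third, one where u agrees with \<open>Pa 1\<close> only lies in the first
  and second.\<close>

lemma colorings_distinct:
  assumes "3 \<le> q" "d + 2 \<le> n"
  shows "distinct [colorings q (G1 n d q), colorings q (G2 n d q),
    colorings q (G3 n d q), colorings q (G4 n d q)]"
proof -
  let ?\<Omega> = "colorings q (G1 n d q)"
  have V: "U_vert \<in> vertices n d q" "W_vert \<in> vertices n d q" "Pa 1 \<in> vertices n d q"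
    using assms by (auto simp: vertices_def path_part_def)
  have eqs: "colorings q (G2 n d q) = {f \<in> ?\<Omega>. f U_vert \<noteq> f W_vert}"
    "colorings q (G3 n d q) = {f \<in> ?\<Omega>. f U_vert \<noteq> f (Pa 1)}"
    "colorings q (G4 n d q) = {f \<in> ?\<Omega>. f U_vert \<noteq> f (Pa 1) \<and> f U_vert \<noteq> f W_vert}"
    by (simp_all add: G1_def G2_def G3_def G4_def colorings_insert_edge[OF V(1,2)]
        colorings_insert_edge[OF V(1,3)] conj_assoc del: One_nat_def)
  have "q - 2 \<noteq> q" using assms(1) by simp
  then obtain f g where "f \<in> ?\<Omega>" "f U_vert = f W_vert" "f U_vert \<noteq> f (Pa 1)"
    and "g \<in> ?\<Omega>" "g U_vert = g (Pa 1)" "g U_vert \<noteq> g W_vert"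
    using ex_coloring_G1[OF assms, of "q - 2" q] ex_coloring_G1[OF assms, of q "q - 2"]
    by (metis insertCI)
  then have "f \<in> ?\<Omega> \<and> f \<notin> colorings q (G2 n d q) \<and> f \<in> colorings q (G3 n d q) \<and> f \<notin> colorings q (G4 n d q)"
    "g \<in> ?\<Omega> \<and> g \<in> colorings q (G2 n d q) \<and> g \<notin> colorings q (G3 n d q) \<and> g \<notin> colorings q (G4 n d q)"
    unfolding eqs by simp_all
  then show ?thesis by (simp only: distinct.simps list.set) blast
qed

section \<open>The sample bound\<close>

text \<open>Halving the exponent absorbs the factor 3: the claim amounts to
  \<open>2 ^ k \<le> L ^ 2\<close>.\<close>

lemma exp_bound_from_linear:
  assumes "2 ^ k + 1 < 3 * L" "1 \<le> k"
  shows "exp (ln 2 / 2 * real k) \<le> real L"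
proof -
  have "2 ^ k \<le> L ^ 2"
  proof (cases "k \<le> 2")
    case True
    \<comment> \<open>For \<open>k = 1\<close> strictness of the assumption matters: it excludes
      \<open>L = 1\<close>, where the claim fails.\<close>
    then have "k = 1 \<or> k = 2" using assms by auto
    then have "2 \<le> L" using assms by auto
    then have "2 ^ 2 \<le> L ^ 2" by (rule power_mono) simp
    then show ?thesis using \<open>k = 1 \<or> k = 2\<close> by auto
  next
    case False
    \<comment> \<open>From \<open>k = 3\<close> on, \<open>(2 ^ k + 1)^2\<close> is at least
      \<open>9 * 2 ^ k\<close>, to be compared with \<open>(3 * L)^2\<close>.\<close>
    then have "2 ^ 3 \<le> (2::nat) ^ k" by (intro power_increasing) auto
    then have "8 \<le> (2::nat) ^ k" by simp
    then have "7 * 2 ^ k \<le> (2::nat) ^ k * 2 ^ k" by (intro mult_right_mono) auto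
    then have "9 * 2 ^ k \<le> (2 ^ k + 1) * (2 ^ k + (1::nat))"
      unfolding distrib_left distrib_right by linarith
    also have "\<dots> \<le> (3 * L) * (3 * L)" using assms(1) by (intro mult_mono) auto
    finally show ?thesis by (simp add: power2_eq_square)
  qed
  then have "real (2 ^ k) \<le> real (L ^ 2)" by (subst of_nat_le_iff)
  then have "(2::real) ^ k \<le> real L ^ 2" by simp
  moreover have "exp (ln 2 / 2 * real k) ^ 2 = (2::real) ^ k"
    by (simp flip: exp_of_nat_mult add: exp_of_nat2_mult)
  ultimately show ?thesis by (metis of_nat_0_le_iff power2_le_imp_le)
qed

lemma learner_sample_bound:
  assumes "3 \<le> q" "q < d" "d + 2 \<le> n"
    and succ: "succeeds_with_prob q (hard_family n d q) L A (1/2)"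
  shows "2 ^ (d - q) + 1 < 3 * L"
proof -
  let ?S = "merged_colorings n d q" and ?H = "{G1 n d q, G2 n d q, G3 n d q, G4 n d q}"
  define k where "k = d - q"
  \<comment> \<open>Mapping the answer to its coloring set turns the four success events into
    distinct points, whose masses sum to at most 1.\<close>
  define R where
    "R = map_pmf (colorings q) (bind_pmf (replicate_pmf L (pmf_of_set ?S)) A)"
  define a where "a G = real (card ?S) / real (card (colorings q G))"
    for G :: "vertex ugraph"
  have sub4: "fst G = vertices n d q \<and> base_edges n d q \<subseteq> snd G \<and> snd G \<subseteq> snd (G4 n d q)"
    if "G \<in> ?H" for G
    using that by (auto simp: G1_def G2_def G3_def G4_def)
  have fam: "G \<in> hard_family n d q" if "G \<in> ?H" for G
    using subgraph_of_G4_bounded_degree[OF assms(1-3), of G] sub4[OF that] that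
    unfolding hard_family_def equiv_class_def by blast
  have SG: "?S \<subseteq> colorings q G" and G1: "colorings q G \<subseteq> colorings q (G1 n d q)" if "G \<in> ?H" for G
  proof -
    have "colorings q (G4 n d q) \<subseteq> colorings q G" "colorings q G \<subseteq> colorings q (G1 n d q)"
      by (rule colorings_antimono; use sub4[OF that] in \<open>simp add: G1_def G4_def\<close>)+
    then show "?S \<subseteq> colorings q G" "colorings q G \<subseteq> colorings q (G1 n d q)"
      using merged_colorings_subset_G4 by blast+
  qed
  have fin: "finite (colorings q G)" if "G \<in> ?H" for G
    using G1[OF that] finite_colorings_G1 finite_subset by blast
  have cardS: "2 ^ k * card (colorings q (G1 n d q)) \<le> (2 ^ k + 1) * card ?S"
    unfolding k_def by (rule card_merged_colorings[OF assms(1)])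
  have "colorings q (G1 n d q) \<noteq> {}" by (rule colorings_nonempty[OF assms(1) fam]) simp
  then have pos1: "card (colorings q (G1 n d q)) > 0"
    by (simp add: card_gt_0_iff finite_colorings_G1)
  with cardS have posS: "card ?S > 0" by (cases "card ?S = 0") auto
  then have neS: "?S \<noteq> {}" by auto
  have key: "a G ^ L * (1 - pmf R (colorings q G)) \<le> 1/2" if "G \<in> ?H" for G
  proof -
    have "pmf R (colorings q G) = measure_pmf.prob (bind_pmf (replicate_pmf L (pmf_of_set ?S)) A)
        {G'. colorings q G' = colorings q G}"
      by (simp add: R_def pmf_map vimage_def)
    moreover have "1/2 \<le> measure_pmf.prob (bind_pmf (replicate_pmf L (pmf_of_set (colorings q G))) A)
        {G'. colorings q G' = colorings q G}"
      using succ fam[OF that] by (simp add: succeeds_with_prob_def coloring_pmf_def)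
    ultimately show ?thesis
      using success_prob_from_subset_samples[OF SG[OF that] fin[OF that] neS] by (simp add: a_def)
  qed
  have dist: "distinct [colorings q (G1 n d q), colorings q (G2 n d q),
      colorings q (G3 n d q), colorings q (G4 n d q)]"
    by (rule colorings_distinct[OF assms(1,3)])
  have "(\<Sum>X\<in>colorings q ` ?H. pmf R X) = measure_pmf.prob R (colorings q ` ?H)"
    by (simp add: measure_measure_pmf_finite)
  then have sum: "pmf R (colorings q (G1 n d q)) + pmf R (colorings q (G2 n d q))
      + pmf R (colorings q (G3 n d q)) + pmf R (colorings q (G4 n d q)) \<le> 1"
    using dist measure_pmf.prob_le_1[of R "colorings q ` ?H"] by (simp add: add.assoc)
  \<comment> \<open>\<open>G1\<close> has the most colorings, hence the smallest share of merged
    ones, so a lower bound for it covers all four graphs.\<close>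
  have a_pos: "0 < a G" and a_mono: "a (G1 n d q) \<le> a G" if "G \<in> ?H" for G
  proof -
    have "card ?S \<le> card (colorings q G)" "card (colorings q G) \<le> card (colorings q (G1 n d q))"
      using SG[OF that] G1[OF that] fin[OF that] finite_colorings_G1 by (auto intro: card_mono)
    then show "0 < a G" "a (G1 n d q) \<le> a G"
      using posS unfolding a_def by (auto intro!: divide_left_mono)
  qed
  \<comment> \<open>Needed only for \<open>d = q + 1\<close>, where the bound must exclude \<open>L = 1\<close>.\<close>
  have strict: "a (G1 n d q) < a (G2 n d q)"
  proof -
    have "card (colorings q (G2 n d q)) < card (colorings q (G1 n d q))"
      using dist G1[of "G2 n d q"] by (intro psubset_card_mono finite_colorings_G1) auto
    moreover have "0 < card (colorings q (G2 n d q))"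
      using a_pos[of "G2 n d q"] by (cases "card (colorings q (G2 n d q)) = 0") (auto simp: a_def)
    ultimately show ?thesis using posS unfolding a_def by (auto intro!: divide_strict_left_mono)
  qed
  \<comment> \<open>2/3 is the break-even value: \<open>2/3 * (1 - r) \<le> 1/2\<close> means
    \<open>r \<ge> 1/4\<close>. Four such masses just fit into 1, so one strict inequality is needed
    for a contradiction.\<close>
  have pmf_ge: "1/4 \<le> pmf R (colorings q G)" if "G \<in> ?H" "2/3 \<le> a G ^ L" for G
  proof -
    have "2/3 * (1 - pmf R (colorings q G)) \<le> a G ^ L * (1 - pmf R (colorings q G))"
      using that(2) by (intro mult_right_mono) (auto simp: pmf_le_1)
    with key[OF that(1)] show ?thesis by simp
  qed
  have pmf_gt: "1/4 < pmf R (colorings q G)" if "G \<in> ?H" "2/3 < a G ^ L" for G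
  proof (rule ccontr)
    assume *: "\<not> 1/4 < pmf R (colorings q G)"
    then have "2/3 * (1 - pmf R (colorings q G)) < a G ^ L * (1 - pmf R (colorings q G))"
      using that(2) by (intro mult_strict_right_mono) auto
    with key[OF that(1)] * show False by simp
  qed
  have small: "a (G1 n d q) ^ L < 2/3"
  proof (rule ccontr)
    assume "\<not> a (G1 n d q) ^ L < 2/3"
    then have ge: "2/3 \<le> a G ^ L" if "G \<in> ?H" for G
      using power_mono[OF a_mono[OF that], of L] a_pos[of "G1 n d q"] by simp
    \<comment> \<open>For \<open>L = 0\<close> the strict comparison of powers is lost, but the
      power is 1.\<close>
    have "2/3 < a (G2 n d q) ^ L"
    proof (cases "L = 0")
      case False
      then have "a (G1 n d q) ^ L < a (G2 n d q) ^ L"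
        using strict a_pos[of "G1 n d q"] by (intro power_strict_mono) auto
      then show ?thesis using ge[of "G1 n d q"] by simp
    qed simp
    then have "1/4 < pmf R (colorings q (G2 n d q))" by (intro pmf_gt) auto
    moreover have "1/4 \<le> pmf R (colorings q (G1 n d q))" "1/4 \<le> pmf R (colorings q (G3 n d q))"
      "1/4 \<le> pmf R (colorings q (G4 n d q))"
      by (rule pmf_ge; use ge in blast)+
    ultimately show False using sum by linarith
  qed
  define b where "b = (2::real) ^ k + 1"
  have b: "b > 1" by (simp add: b_def)
  have "real (2 ^ k * card (colorings q (G1 n d q))) \<le> real ((2 ^ k + 1) * card ?S)"
    using cardS by (subst of_nat_le_iff)
  then have "(b - 1) * real (card (colorings q (G1 n d q))) \<le> b * real (card ?S)"
    by (simp add: b_def algebra_simps)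
  then have a1: "1 - 1 / b \<le> a (G1 n d q)"
    using pos1 b by (simp add: a_def field_simps)
  \<comment> \<open>Bernoulli gives \<open>1 - L / b < 2/3\<close>, which is
    \<open>b < 3 * L\<close>.\<close>
  have "1 + real L * (- 1 / b) \<le> (1 + (- 1 / b)) ^ L"
    by (rule Bernoulli_inequality) (use b in simp)
  also have "\<dots> \<le> a (G1 n d q) ^ L"
    using a1 b by (intro power_mono) auto
  finally have "1/3 < real L / b" using small by simp
  then have "b < 3 * real L" using b by (simp add: field_simps)
  then have "real (2 ^ k + 1) < real (3 * L)" by (simp add: b_def)
  then show ?thesis unfolding k_def by (simp only: of_nat_less_iff)
qed

theorem theorem9:
  shows "\<exists>c::real. c > 0 \<and>
    (\<forall>(d::nat) (q::nat) (n::nat) (L::nat)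
       (A :: (vertex \<Rightarrow> nat) list \<Rightarrow> vertex ugraph pmf).
       3 \<le> q \<longrightarrow> q < d \<longrightarrow> d + 2 \<le> n \<longrightarrow>
       equiv_structure_learner q (hard_family n d q) L A \<longrightarrow>
       succeeds_with_prob q (hard_family n d q) L A (1/2) \<longrightarrow>
       real L \<ge> exp (c * real (d - q)))"
proof (intro exI[of _ "ln 2 / 2"] conjI allI impI)
  fix d q n L and A :: "(vertex \<Rightarrow> nat) list \<Rightarrow> vertex ugraph pmf"
  assume "3 \<le> q" "q < d" "d + 2 \<le> n"
    and "succeeds_with_prob q (hard_family n d q) L A (1/2)"
  then show "exp (ln 2 / 2 * real (d - q)) \<le> real L"
    by (intro exp_bound_from_linear learner_sample_bound) auto
qed simp

end
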